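(* Let $X$ be a heavy-tailed random variable with hazard function $R$. Then there exists a concave function $h\colon[0,\infty)\to[0,\infty)$ with $h(0)=0$ such that $$\liminf_{x\to\infty}\frac{R(x)}{h(x)}=1.$$ Equivalently, there exist numbers $a,b\in(0,\infty)$ and a concave function $h^*\colon[0,\infty)\to[0,\infty)$ with $h^*(0)=0$ such that $$E\big(e^{a h^*(X)}\big)<\infty\quad\text{and}\quad E\big(e^{b h^*(X)}\big)=\infty .$$ (That is, the two existence assertions are equivalent, and both hold.)
   Context: For a real random variable $X$ with distribution function $F_X(x)=P(X\le x)$, the tail function is $\overline F_X=1-F_X$ and the hazard function is $R=R_X=-\log\overline F_X$. All random variables are assumed essentially unbounded from above: $P(X>a)>0$ for all $a>0$. A random variable $X$ is light-tailed if $\sup\{s\ge 0: E(e^{sX})<\infty\}>0$ (equivalently, for essentially unbounded $X$, $\liminf_{x\to\infty}R_X(x)/x>0$); otherwise it is heavy-tailed, i.e. $E(e^{sX})=\infty$ for every $s>0$. Write $x^+=\max(0,x)$. For a function $h^*$ defined on $[0,\infty)$ and a random variable $X$ that may take negative values, $h^*(X)$ is understood as $h^*(X^+)$. *)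

theory Defs
  imports "HOL-Probability.Probability"
begin

definition tail_fun :: "'a measure \<Rightarrow> ('a \<Rightarrow> real) \<Rightarrow> real \<Rightarrow> real" where
  "tail_fun M X x = 1 - cdf (distr M borel X) x"

(* Under ess_unbounded_above the tail never vanishes, so the convention ln 0 = 0 plays no role. *)
definition hazard :: "'a measure \<Rightarrow> ('a \<Rightarrow> real) \<Rightarrow> real \<Rightarrow> real" where
  "hazard M X x = - ln (tail_fun M X x)"

definition ess_unbounded_above :: "'a measure \<Rightarrow> ('a \<Rightarrow> real) \<Rightarrow> bool" where
  "ess_unbounded_above M X \<longleftrightarrow> (\<forall>a>0. measure M {\<omega> \<in> space M. X \<omega> > a} > 0)"

(* E(exp Y) as a nonnegative Lebesgue integral, so that the value infinity is meaningful;
   the Bochner integral would return 0 there. *)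
definition expect_exp :: "'a measure \<Rightarrow> ('a \<Rightarrow> real) \<Rightarrow> ennreal" where
  "expect_exp M Y = (\<integral>\<^sup>+ \<omega>. ennreal (exp (Y \<omega>)) \<partial>M)"

(* The supremum is taken in ereal because the set may be unbounded. *)
definition light_tailed :: "'a measure \<Rightarrow> ('a \<Rightarrow> real) \<Rightarrow> bool" where
  "light_tailed M X \<longleftrightarrow>
     (SUP s \<in> {s::real. 0 \<le> s \<and> expect_exp M (\<lambda>\<omega>. s * X \<omega>) < \<infinity>}. ereal s) > 0"

definition heavy_tailed :: "'a measure \<Rightarrow> ('a \<Rightarrow> real) \<Rightarrow> bool" where
  "heavy_tailed M X \<longleftrightarrow> \<not> light_tailed M X"

lemma heavy_tailed_iff:
  "heavy_tailed M X \<longleftrightarrow> (\<forall>s>0. expect_exp M (\<lambda>\<omega>. s * X \<omega>) = \<infinity>)"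
  unfolding heavy_tailed_def light_tailed_def less_SUP_iff
  by (auto simp: less_top[symmetric] dest: less_imp_le)

end

theory Submission
  imports Defs
begin

text \<open>
  Both assertions follow from one concave function \<open>h\<close>, and the point is to find \<open>h\<close> with
  \<open>h \<le> R + 2\<close> on \<open>[0, \<infinity>)\<close> and \<open>R x \<le> h x\<close> for arbitrarily large \<open>x\<close>. Additive constants do not
  matter, because \<open>R\<close>, and with it \<open>h\<close>, tends to infinity.

  Heavy-tailedness enters only through the fact that every line \<open>s x - K\<close> of positive slope \<open>s\<close>
  is somewhere above \<open>R\<close> (\<open>heavy_tailed_hazard_sublinear\<close>); otherwise \<open>X\<close> would have an exponential
  moment. So \<open>h\<close> can be drawn as a polygon with decreasing slopes. From a vertex that is at most 1
  above the graph of \<open>R\<close>, one continues along a line so flat that \<open>R\<close> has time to overtake it, and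
  follows this line until it catches up with \<open>R\<close> again; there is the next vertex
  (\<open>line_crossing_step\<close>). Some additive slack between \<open>h\<close> and \<open>R\<close> is needed because \<open>R\<close> may be constant to the right of the
  vertex, in which case no line of positive slope stays below \<open>R\<close> there. The polygon is the infimum
  of the lines that carry its edges, so it is concave (\<open>exists_concave_comparison\<close>).

  The limit inferior of \<open>R / h\<close> is then 1 (\<open>Liminf_ratio_eq_1\<close>). The expectation of
  \<open>exp (2 h(X))\<close> is infinite, because it is at least \<open>exp (2 h x - R x)\<close> for each \<open>x\<close>, hence at least
  \<open>exp (h x)\<close> at the vertices (\<open>expect_exp_ge\<close>). The expectation of \<open>exp (h(X) / 2)\<close> is finite,
  because \<open>h \<le> R + 2\<close> makes \<open>P(h(X) > n)\<close> at most a constant times \<open>exp (- n)\<close>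
  (\<open>expect_exp_finite\<close>).
\<close>

section \<open>A concave function close to a sublinear one\<close>

text \<open>
  One edge of the polygon, starting at \<open>(x, p)\<close>. The slope \<open>e\<close> is chosen so that the line climbs by
  at most 1 until the point \<open>y\<close> where \<open>R\<close> has reached \<open>p + 1\<close>; up to \<open>y\<close> the line is below \<open>R + 2\<close>
  merely because \<open>R\<close> is monotone. The crossing is then sought among the points \<open>y\<close>, \<open>y + 1\<close>,
  \<open>y + 2\<close>, and so on. At the first of these where the line has reached \<open>R\<close>, it exceeds \<open>R\<close> by at most \<open>e \<le> 1\<close>,
  whatever jumps \<open>R\<close> has.
\<close>
lemma line_crossing_step:
  fixes R :: "real \<Rightarrow> real"
  assumes mono: "mono R" and nonneg: "\<And>x. 0 \<le> R x"
    and unbounded: "\<And>K. \<exists>x. K \<le> R x"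
    and sublinear: "\<And>s K. 0 < s \<Longrightarrow> \<exists>x\<ge>0. R x \<le> s * x - K"
    and p: "p \<le> R x + 1" and e0: "0 < e0"
  shows "\<exists>e x'. 0 < e \<and> e \<le> e0 \<and> x + 1 \<le> x' \<and>
           R x' \<le> p + e * (x' - x) \<and> p + e * (x' - x) \<le> R x' + 1 \<and>
           (\<forall>z\<in>{x..x'}. p + e * (z - x) \<le> R z + 2)"
proof -
  obtain y0 where y0: "p + 1 \<le> R y0" using unbounded by blast
  define y where "y = max y0 (x + 1)"
  have y: "x + 1 \<le> y" "p + 1 \<le> R y"
    using y0 monoD[OF mono, of y0 y] by (auto simp: y_def)
  define e where "e = min e0 (1 / (y - x))"
  have e: "0 < e" "e \<le> e0" "e \<le> 1 / (y - x)" using y e0 by (auto simp: e_def)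
  have "1 / (y - x) \<le> 1" using y by simp
  then have e1: "e \<le> 1" using e by linarith
  define L where "L z = p + e * (z - x)" for z
  have L_mono: "L z \<le> L z'" if "z \<le> z'" for z z'
    using that e by (simp add: L_def mult_left_mono)
  have L_Suc: "L (z + 1) = L z + e" for z by (simp add: L_def algebra_simps)
  have Ly: "L y \<le> p + 1" using e(3) y by (simp add: L_def field_simps)
  \<comment> \<open>With this \<open>K\<close>, a point \<open>w\<close> where \<open>R w \<le> e * w - K\<close> lies to the right of \<open>y\<close>, and the line is
    above \<open>R\<close> there by at least \<open>e\<close>, so that it is still above \<open>R\<close> after rounding \<open>w\<close> down by less
    than 1 to a point of the grid.\<close>
  define K where "K = e * \<bar>y\<bar> + e + e * \<bar>x\<bar> + \<bar>p\<bar>"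
  obtain w where w: "R w \<le> e * w - K" using sublinear[OF e(1)] by blast
  have "e * y \<le> e * \<bar>y\<bar>" using e by (intro mult_left_mono) auto
  moreover have "e * x \<le> e * \<bar>x\<bar>" using e by (intro mult_left_mono) auto
  moreover have "0 \<le> e * \<bar>x\<bar>" "0 \<le> e * \<bar>y\<bar>" using e by auto
  ultimately have "e * y \<le> e * w" and K: "e + e * x - p \<le> K"
    using w nonneg[of w] e(1) unfolding K_def by linarith+
  then have wy: "y \<le> w" using e by simp
  define N where "N = nat \<lfloor>w - y\<rfloor>"
  have N: "y + real N \<le> w" "w \<le> (y + real N) + 1"
    using wy unfolding N_def by linarith+
  have "R (y + real N) \<le> e * w - K" using w monoD[OF mono N(1)] by simp
  also have "\<dots> \<le> L w - e" using K by (simp add: L_def algebra_simps)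
  also have "\<dots> \<le> L (y + real N)" using L_mono[OF N(2)] L_Suc by simp
  finally have ex: "R (y + real N) \<le> L (y + real N)" .
  define j where "j = (LEAST i. R (y + real i) \<le> L (y + real i))"
  have j: "R (y + real j) \<le> L (y + real j)"
    unfolding j_def by (rule LeastI, rule ex)
  have below: "L (y + real i) \<le> R (y + real i)" if "i < j" for i
    using not_less_Least[of i "\<lambda>i. R (y + real i) \<le> L (y + real i)"] that
    by (simp add: j_def)
  have j': "L (y + real j) \<le> R (y + real j) + 1"
  proof (cases j)
    case 0
    then show ?thesis using Ly y by simp
  next
    case (Suc k)
    have eq: "y + real j = (y + real k) + 1" using Suc by simp
    have "L (y + real j) \<le> R (y + real k) + 1"
      unfolding eq L_Suc using below[of k] e1 Suc by simp
    also have "R (y + real k) \<le> R (y + real j)" using monoD[OF mono] Suc by simp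
    finally show ?thesis by simp
  qed
  have "L z \<le> R z + 2" if z: "x \<le> z" "z \<le> y + real j" for z
  proof (cases "z \<le> y")
    case True
    then have "L z \<le> p + 1" using L_mono Ly by force
    then show ?thesis using p monoD[OF mono z(1)] by simp
  next
    case False
    define k where "k = nat \<lfloor>z - y\<rfloor>"
    have k: "y + real k \<le> z" "z \<le> (y + real k) + 1"
      using False unfolding k_def by linarith+
    show ?thesis
    proof (cases "k < j")
      case True
      have "L z \<le> L (y + real k) + e" using L_mono[OF k(2)] L_Suc by simp
      then show ?thesis using below[OF True] e1 monoD[OF mono k(1)] by simp
    next
      case False
      then have "z = y + real j" using k z by linarith
      then show ?thesis using j' by simp
    qed
  qed
  then show ?thesis
    using e y j j' by (intro exI[of _ e] exI[of _ "y + real j"]) (auto simp: L_def)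
qed

text \<open>
  The edges are chained by dependent choice. The lines through consecutive vertices cross at the
  vertices, and the slopes decrease, so at the abscissa of a vertex every line of the family has at
  least the height of that vertex: the infimum of the lines passes through all the vertices. The
  construction starts at the origin, which gives \<open>h 0 = 0\<close> even when \<open>R 0 > 0\<close>, since a vertex only
  has to satisfy the upper bound \<open>p \<le> R x + 1\<close>.
\<close>
lemma exists_concave_comparison:
  fixes R :: "real \<Rightarrow> real"
  assumes mono: "mono R" and nonneg: "\<And>x. 0 \<le> R x"
    and unbounded: "\<And>K. \<exists>x. K \<le> R x"
    and sublinear: "\<And>s K. 0 < s \<Longrightarrow> \<exists>x\<ge>0. R x \<le> s * x - K"
  obtains h :: "real \<Rightarrow> real" where
    "h \<in> {0..} \<rightarrow> {0..}" "concave_on {0..} h" "h 0 = 0"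
    "mono_on {0..} h" "continuous_on {0..} h"
    "\<And>z. 0 \<le> z \<Longrightarrow> h z \<le> R z + 2"
    "\<And>N. \<exists>x\<ge>N. 0 \<le> x \<and> R x \<le> h x"
proof -
  \<comment> \<open>A state \<open>(x, p, e)\<close> is a vertex \<open>(x, p)\<close> with the slope of the edge that ends there; in the
    initial state the slope is just a bound for the first edge.\<close>
  define Q :: "real \<times> real \<times> real \<Rightarrow> real \<times> real \<times> real \<Rightarrow> bool" where
    "Q = (\<lambda>(x, p, e0) (x', p', e). 0 < e \<and> e \<le> e0 \<and> x + 1 \<le> x' \<and>
           p' = p + e * (x' - x) \<and> R x' \<le> p' \<and> p' \<le> R x' + 1 \<and>
           (\<forall>z\<in>{x..x'}. p + e * (z - x) \<le> R z + 2))"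
  define P :: "nat \<Rightarrow> real \<times> real \<times> real \<Rightarrow> bool" where
    "P = (\<lambda>n (x, p, e). p \<le> R x + 1 \<and> 0 < e \<and> (n = 0 \<longrightarrow> x = 0 \<and> p = 0))"
  have "\<exists>f. \<forall>n. P n (f n) \<and> Q (f n) (f (Suc n))"
  proof (rule dependent_nat_choice)
    show "\<exists>s. P 0 s" using nonneg[of 0] by (intro exI[of _ "(0, 0, 1)"]) (simp add: P_def)
  next
    fix s n assume s: "P n s"
    obtain x p e0 where [simp]: "s = (x, p, e0)" by (cases s) auto
    have "p \<le> R x + 1" "0 < e0" using s by (auto simp: P_def)
    from line_crossing_step[OF mono nonneg unbounded sublinear this]
    obtain e x' where "0 < e" "e \<le> e0" "x + 1 \<le> x'"
      "R x' \<le> p + e * (x' - x)" "p + e * (x' - x) \<le> R x' + 1"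
      "\<forall>z\<in>{x..x'}. p + e * (z - x) \<le> R z + 2" by blast
    then show "\<exists>s'. P (Suc n) s' \<and> Q s s'"
      by (intro exI[of _ "(x', p + e * (x' - x), e)"]) (auto simp: P_def Q_def)
  qed
  then obtain f where f: "\<And>n. P n (f n)" "\<And>n. Q (f n) (f (Suc n))" by blast
  define x where "x n = fst (f n)" for n
  define p where "p n = fst (snd (f n))" for n
  define e where "e n = snd (snd (f (Suc n)))" for n
  have start: "x 0 = 0" "p 0 = 0"
    using f(1)[of 0] by (auto simp: P_def x_def p_def split: prod.splits)
  have step: "0 < e n" "x n + 1 \<le> x (Suc n)" "p (Suc n) = p n + e n * (x (Suc n) - x n)"
    "R (x (Suc n)) \<le> p (Suc n)"
    "\<And>z. x n \<le> z \<Longrightarrow> z \<le> x (Suc n) \<Longrightarrow> p n + e n * (z - x n) \<le> R z + 2" for n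
    using f(2)[of n] by (auto simp: Q_def x_def p_def e_def split: prod.splits)
  have e_dec: "e (Suc n) \<le> e n" for n
    using f(2)[of "Suc n"] by (auto simp: Q_def e_def split: prod.splits)
  have e0: "e n \<le> e 0" for n
    using decseqD[OF decseq_SucI, of e 0 n] e_dec by simp
  have x_mono: "x m \<le> x n" if "m \<le> n" for m n
    by (rule lift_Suc_mono_le[OF _ that]) (use step(2) in \<open>smt (verit)\<close>)
  have x_ge: "real n \<le> x n" for n
  proof (induction n)
    case (Suc n)
    then show ?case using step(2)[of n] by simp
  qed (simp add: start)

  define L where "L n z = p n + e n * (z - x n)" for n z
  have L_x: "L n (x n) = p n" for n by (simp add: L_def)
  have L_diff: "L (Suc n) z - L n z = (e n - e (Suc n)) * (x (Suc n) - z)" for n z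
    by (simp add: L_def step(3) algebra_simps)
  have touch: "p n \<le> L k (x n)" for n k
  proof (cases "n \<le> k")
    case True
    then show ?thesis
    proof (induction k rule: dec_induct)
      case (step k)
      have "0 \<le> L (Suc k) (x n) - L k (x n)"
        unfolding L_diff using e_dec[of k] x_mono[of n "Suc k"] step by simp
      then show ?case using step by simp
    qed (simp add: L_x)
  next
    case False
    then have "k \<le> n" by simp
    then show ?thesis
    proof (induction k rule: inc_induct)
      case (step k)
      have "(e k - e (Suc k)) * (x (Suc k) - x n) \<le> 0"
        using e_dec[of k] x_mono[of "Suc k" n] step by (intro mult_nonneg_nonpos) auto
      then show ?case using step L_diff[of k "x n"] by simp
    qed (simp add: L_x)
  qed
  have L_mono: "L n z \<le> L n z'" if "z \<le> z'" for n z z'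
    using that step(1)[of n] by (simp add: L_def)
  have L_nonneg: "0 \<le> L n z" if "0 \<le> z" for n z
    using touch[of 0 n] L_mono[OF that, of n] by (simp add: start)
  have L_lip: "L n z' \<le> L n z + e 0 * (z' - z)" if "z \<le> z'" for n z z'
    using mult_right_mono[OF e0[of n], of "z' - z"] that by (simp add: L_def algebra_simps)

  define h where "h z = (INF n. L n z)" for z
  have bdd: "bdd_below (range (\<lambda>n. L n z))" if "0 \<le> z" for z
    using L_nonneg[OF that] by (auto intro!: bdd_belowI2[of _ 0])
  have h_le: "h z \<le> L n z" if "0 \<le> z" for n z
    unfolding h_def by (rule cINF_lower[OF bdd[OF that]]) simp
  have h_greatest: "c \<le> h z" if "\<And>n. c \<le> L n z" for c z
    unfolding h_def by (rule cINF_greatest) (use that in auto)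
  have h_nonneg: "0 \<le> h z" if "0 \<le> z" for z
    using L_nonneg[OF that] by (rule h_greatest)
  have h_x: "p n \<le> h (x n)" for n
    using touch by (rule h_greatest)
  have h_mono: "h z \<le> h z'" if "0 \<le> z" "z \<le> z'" for z z'
    by (rule h_greatest) (use h_le[OF that(1)] L_mono[OF that(2)] order_trans in blast)
  have h_lip: "h z' \<le> h z + e 0 * (z' - z)" if "0 \<le> z" "z \<le> z'" for z z'
  proof -
    have "h z' - e 0 * (z' - z) \<le> h z"
    proof (rule h_greatest)
      fix n
      show "h z' - e 0 * (z' - z) \<le> L n z"
        using h_le[of z' n] L_lip[OF that(2), of n] that by simp
    qed
    then show ?thesis by simp
  qed
  have lip: "(e 0)-lipschitz_on {0..} h"
  proof (rule lipschitz_onI)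
    fix z z' :: real assume "z \<in> {0..}" "z' \<in> {0..}"
    then show "dist (h z) (h z') \<le> e 0 * dist z z'"
      using h_lip[of z z'] h_mono[of z z'] h_lip[of z' z] h_mono[of z' z]
      by (cases z z' rule: linorder_cases) (auto simp: dist_real_def)
  qed (use step(1)[of 0] in simp)
  have concave: "concave_on {0..} h"
    unfolding concave_on_iff
  proof (intro conjI ballI allI impI)
    fix a b u v :: real
    assume ab: "a \<in> {0..}" "b \<in> {0..}" and uv: "0 \<le> u" "0 \<le> v" "u + v = 1"
    show "u * h a + v * h b \<le> h (u *\<^sub>R a + v *\<^sub>R b)"
    proof (rule h_greatest)
      fix n
      have "u * h a + v * h b \<le> u * L n a + v * L n b"
        using ab uv h_le by (intro add_mono mult_left_mono) auto
      also have "\<dots> = (u + v) * (p n - e n * x n) + e n * (u * a + v * b)"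
        by (simp add: L_def algebra_simps)
      also have "\<dots> = L n (u *\<^sub>R a + v *\<^sub>R b)"
        unfolding uv by (simp add: L_def algebra_simps)
      finally show "u * h a + v * h b \<le> L n (u *\<^sub>R a + v *\<^sub>R b)" .
    qed
  qed simp
  have upper: "h z \<le> R z + 2" if "0 \<le> z" for z
  proof -
    obtain n where n: "z < real n" using reals_Archimedean2 by blast
    have "\<exists>n. x n \<le> z \<and> z \<le> x (Suc n)"
    proof (rule ccontr)
      assume no: "\<nexists>n. x n \<le> z \<and> z \<le> x (Suc n)"
      have "x n \<le> z" for n
      proof (induction n)
        case (Suc n)
        then show ?case using no by (meson linear)
      qed (simp add: start that)
      then show False using x_ge[of n] n by (smt (verit))
    qed
    then obtain n where "x n \<le> z" "z \<le> x (Suc n)" by blast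
    then show ?thesis using step(5)[of n z] h_le[OF that, of n] by (simp add: L_def)
  qed
  show ?thesis
  proof (rule that[of h])
    show "h \<in> {0..} \<rightarrow> {0..}" using h_nonneg by auto
    show "h 0 = 0" using h_nonneg[of 0] h_le[of 0 0] L_x[of 0] by (simp add: start)
    show "mono_on {0..} h" using h_mono by (auto intro!: mono_onI)
    show "continuous_on {0..} h" using lip by (rule lipschitz_on_continuous_on)
    fix N :: real
    obtain n where n: "N < real n" using reals_Archimedean2 by blast
    have "N \<le> x (Suc n)" "0 \<le> x (Suc n)" using n x_ge[of "Suc n"] by auto
    then show "\<exists>x\<ge>N. 0 \<le> x \<and> R x \<le> h x"
      using order_trans[OF step(4) h_x] by blast
  qed (use concave upper in auto)
qed

section \<open>The hazard function\<close>

lemma tail_fun_eq_measure: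
  assumes "prob_space M" "X \<in> borel_measurable M"
  shows "tail_fun M X x = measure M {\<omega> \<in> space M. X \<omega> > x}"
proof -
  interpret prob_space M by fact
  have "cdf (distr M borel X) x = prob {\<omega> \<in> space M. X \<omega> \<le> x}"
    using assms(2) by (auto simp: cdf_def measure_distr intro!: arg_cong[where f = prob])
  also have "\<dots> = 1 - prob {\<omega> \<in> space M. \<not> X \<omega> \<le> x}"
    using assms(2) by (subst prob_neg) auto
  finally show ?thesis by (simp add: tail_fun_def not_le)
qed

lemma tail_fun_pos:
  assumes "prob_space M" "X \<in> borel_measurable M" "ess_unbounded_above M X"
  shows "0 < tail_fun M X x"
proof -
  interpret prob_space M by fact
  have "0 < prob {\<omega> \<in> space M. X \<omega> > max x 1}"
    using assms(3) by (simp add: ess_unbounded_above_def del: max_less_iff_conj)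
  also have "\<dots> \<le> prob {\<omega> \<in> space M. X \<omega> > x}"
    using assms(2) by (intro finite_measure_mono) auto
  finally show ?thesis using assms by (simp add: tail_fun_eq_measure)
qed

lemma exp_minus_hazard:
  assumes "prob_space M" "X \<in> borel_measurable M" "ess_unbounded_above M X"
  shows "measure M {\<omega> \<in> space M. X \<omega> > x} = exp (- hazard M X x)"
  using tail_fun_pos[OF assms, of x] assms
  by (simp add: hazard_def tail_fun_eq_measure)

lemma mono_hazard:
  assumes "prob_space M" "X \<in> borel_measurable M" "ess_unbounded_above M X"
  shows "mono (hazard M X)"
proof (rule monoI)
  fix x y :: real assume "x \<le> y"
  interpret prob_space M by fact
  have "prob {\<omega> \<in> space M. X \<omega> > y} \<le> prob {\<omega> \<in> space M. X \<omega> > x}"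
    using assms(2) \<open>x \<le> y\<close> by (intro finite_measure_mono) auto
  then show "hazard M X x \<le> hazard M X y" by (simp add: exp_minus_hazard[OF assms])
qed

lemma hazard_nonneg:
  assumes "prob_space M" "X \<in> borel_measurable M" "ess_unbounded_above M X"
  shows "0 \<le> hazard M X x"
  using prob_space.prob_le_1[OF assms(1), of "{\<omega> \<in> space M. X \<omega> > x}"]
  by (simp add: exp_minus_hazard[OF assms])

lemma hazard_unbounded:
  assumes "prob_space M" "X \<in> borel_measurable M" "ess_unbounded_above M X"
  shows "\<exists>x. K \<le> hazard M X x"
proof -
  interpret prob_space M by fact
  interpret D: real_distribution "distr M borel X"
    using assms(2) by (rule real_distribution_distr)
  have "((\<lambda>x. 1 - cdf (distr M borel X) x) \<longlongrightarrow> 1 - 1) at_top"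
    by (intro tendsto_diff tendsto_const D.cdf_lim_at_top_prob)
  then have "(tail_fun M X \<longlongrightarrow> 0) at_top" by (simp add: tail_fun_def[abs_def])
  then have "eventually (\<lambda>x. tail_fun M X x < exp (- K)) at_top"
    by (rule order_tendstoD) simp
  then obtain x where "tail_fun M X x < exp (- K)"
    using eventually_happens by fastforce
  then have "exp (- hazard M X x) < exp (- K)"
    using exp_minus_hazard[OF assms, of x] assms by (simp add: tail_fun_eq_measure)
  then show ?thesis by (intro exI[of _ x]) simp
qed

section \<open>Exponential moments and the hazard function\<close>

text \<open>
  The values of \<open>h(X\<^sup>+)\<close>, not those of \<open>X\<close>, are cut into unit intervals. By continuity \<open>h\<close> takes the
  value \<open>n\<close> at some \<open>x\<close>, and monotonicity turns \<open>h(X\<^sup>+) > n\<close> into \<open>X > x\<close>, an event of probability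
  \<open>exp (- R x) \<le> exp (K - c n)\<close>. Hence the expectation is dominated by a geometric series with ratio
  \<open>exp (a - c)\<close>. Cutting at integer values of \<open>X\<close> would not do, because \<open>exp (- R n)\<close> need not be
  summable when \<open>R\<close> grows slowly.
\<close>
lemma expect_exp_finite:
  assumes X: "prob_space M" "X \<in> borel_measurable M" "ess_unbounded_above M X"
    and mono: "mono_on {0..} h" and cont: "continuous_on {0..} h" and h0: "h 0 = 0"
    and unbounded: "\<And>t. \<exists>x\<ge>0. t \<le> h x"
    and le: "\<And>x. 0 \<le> x \<Longrightarrow> c * h x - K \<le> hazard M X x"
    and a: "0 \<le> a" "a < c"
  shows "expect_exp M (\<lambda>\<omega>. a * h (max 0 (X \<omega>))) < \<infinity>"
proof -
  interpret prob_space M by fact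
  have level: "\<exists>x\<ge>0. h x = real n" for n
  proof -
    obtain y where "0 \<le> y" "real n \<le> h y" using unbounded by blast
    then show ?thesis
      using IVT'[of h 0 "real n" y] h0 continuous_on_subset[OF cont, of "{0..y}"] by auto
  qed
  then obtain x where x: "\<And>n. 0 \<le> x n" "\<And>n. h (x n) = real n" by metis
  define Y where "Y \<omega> = h (max 0 (X \<omega>))" for \<omega>
  have "mono (\<lambda>t. h (max 0 t))"
    by (intro monoI mono_onD[OF mono]) auto
  from borel_measurable_mono[OF this] have Y[measurable]: "Y \<in> borel_measurable M"
    unfolding Y_def using X(2) by measurable
  have Y_nonneg: "0 \<le> Y \<omega>" for \<omega>
    using mono_onD[OF mono, of 0 "max 0 (X \<omega>)"] by (simp add: Y_def h0)
  define S where "S n = {\<omega> \<in> space M. Y \<omega> > real n}" for n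
  have S[measurable]: "S n \<in> sets M" for n unfolding S_def by measurable
  have prob_S: "prob (S n) \<le> exp K * exp (- c) ^ n" for n
  proof -
    have "S n \<subseteq> {\<omega> \<in> space M. X \<omega> > x n}"
    proof
      fix \<omega> assume \<omega>: "\<omega> \<in> S n"
      have "\<not> max 0 (X \<omega>) \<le> x n"
        using \<omega> mono_onD[OF mono, of "max 0 (X \<omega>)" "x n"] x by (auto simp: S_def Y_def)
      then show "\<omega> \<in> {\<omega> \<in> space M. X \<omega> > x n}" using \<omega> x(1)[of n] by (auto simp: S_def)
    qed
    then have "prob (S n) \<le> prob {\<omega> \<in> space M. X \<omega> > x n}"
      using X(2) by (intro finite_measure_mono) auto
    also have "\<dots> = exp (- hazard M X (x n))" by (rule exp_minus_hazard[OF X])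
    also have "\<dots> \<le> exp (K - c * real n)" using le[OF x(1)[of n]] x(2)[of n] by simp
    also have "\<dots> = exp K * exp (- c) ^ n"
      by (simp add: exp_diff exp_minus field_simps flip: exp_of_nat_mult)
    finally show ?thesis .
  qed
  have pointwise: "ennreal (exp (a * Y \<omega>)) \<le>
      1 + (\<Sum>n. ennreal (exp (a * (real n + 1))) * indicator (S n) \<omega>)" (is "_ \<le> 1 + (\<Sum>n. ?g n)")
    if "\<omega> \<in> space M" for \<omega>
  proof (cases "Y \<omega> = 0")
    case False
    then have pos: "0 < Y \<omega>" using Y_nonneg[of \<omega>] by simp
    \<comment> \<open>The unit interval \<open>(n, n + 1]\<close> that contains \<open>Y \<omega>\<close>.\<close>
    define n where "n = nat (\<lceil>Y \<omega>\<rceil> - 1)"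
    have n: "real n < Y \<omega>" "Y \<omega> \<le> real n + 1" using pos unfolding n_def by linarith+
    have "ennreal (exp (a * Y \<omega>)) \<le> ?g n"
      using n that a by (auto simp: S_def mult_left_mono)
    also have "\<dots> \<le> (\<Sum>n. ?g n)" using sum_le_suminf[OF summableI, of "{n}" ?g] by (simp del: sum_mult_indicator)
    also have "\<dots> \<le> 1 + (\<Sum>n. ?g n)" by simp
    finally show ?thesis .
  qed simp
  have "expect_exp M (\<lambda>\<omega>. a * Y \<omega>) \<le>
      (\<integral>\<^sup>+ \<omega>. 1 + (\<Sum>n. ennreal (exp (a * (real n + 1))) * indicator (S n) \<omega>) \<partial>M)"
    unfolding expect_exp_def using pointwise by (intro nn_integral_mono) auto
  also have "\<dots> = 1 + (\<Sum>n. ennreal (exp (a * (real n + 1))) * emeasure M (S n))"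
    by (subst nn_integral_add) (auto simp: nn_integral_suminf nn_integral_cmult emeasure_space_1)
  also have "\<dots> \<le> 1 + (\<Sum>n. ennreal (exp (a + K) * exp (a - c) ^ n))"
  proof (intro add_left_mono suminf_le summableI)
    fix n
    have "ennreal (exp (a * (real n + 1))) * emeasure M (S n) \<le>
        ennreal (exp (a * (real n + 1)) * (exp K * exp (- c) ^ n))"
      unfolding emeasure_eq_measure
      by (subst ennreal_mult[symmetric]) (auto intro!: ennreal_leI prob_S)
    also have "exp (a * (real n + 1)) * (exp K * exp (- c) ^ n) = exp (a + K) * exp (a - c) ^ n"
      by (simp add: exp_add exp_diff exp_minus field_simps flip: exp_of_nat_mult)
    finally show "ennreal (exp (a * (real n + 1))) * emeasure M (S n) \<le>
        ennreal (exp (a + K) * exp (a - c) ^ n)" .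
  qed
  also have "\<dots> < \<infinity>"
  proof -
    have "summable (\<lambda>n. exp (a + K) * exp (a - c) ^ n)"
      using a by (intro summable_mult summable_geometric) simp
    then have "(\<Sum>n. ennreal (exp (a + K) * exp (a - c) ^ n)) \<noteq> top"
      by (rule ennreal_suminf_neq_top) simp
    moreover have "1 + t < \<infinity>" if "t \<noteq> top" for t :: ennreal
      using that by (simp add: less_top)
    ultimately show ?thesis by blast
  qed
  finally show ?thesis by (simp add: Y_def)
qed

text \<open>Restricting the expectation to the event \<open>X > x\<close> is enough (Markov's inequality).\<close>
lemma expect_exp_ge:
  assumes X: "prob_space M" "X \<in> borel_measurable M" "ess_unbounded_above M X"
    and mono: "mono_on {0..} h" and x: "0 \<le> x" and b: "0 \<le> b"
  shows "ennreal (exp (b * h x - hazard M X x)) \<le> expect_exp M (\<lambda>\<omega>. b * h (max 0 (X \<omega>)))"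
proof -
  interpret prob_space M by fact
  let ?E = "{\<omega> \<in> space M. X \<omega> > x}"
  have E: "?E \<in> sets M" using X(2) by measurable
  have "ennreal (exp (b * h x - hazard M X x)) = ennreal (exp (b * h x)) * emeasure M ?E"
    by (simp add: emeasure_eq_measure exp_minus_hazard[OF X] flip: ennreal_mult exp_add)
  also have "\<dots> = (\<integral>\<^sup>+ \<omega>. ennreal (exp (b * h x)) * indicator ?E \<omega> \<partial>M)"
    using E by (simp add: nn_integral_cmult)
  also have "\<dots> \<le> (\<integral>\<^sup>+ \<omega>. ennreal (exp (b * h (max 0 (X \<omega>)))) \<partial>M)"
    using x b mono_onD[OF mono, of x]
    by (intro nn_integral_mono) (auto simp: indicator_def intro!: mult_left_mono)
  finally show ?thesis by (simp add: expect_exp_def)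
qed

text \<open>
  If \<open>R\<close> stayed above a line of positive slope \<open>s\<close>, then the identity in place of \<open>h\<close> in
  \<open>expect_exp_finite\<close> would give \<open>X\<^sup>+\<close>, and so \<open>X\<close>, an exponential moment of order \<open>s / 2\<close>. Since \<open>K\<close>
  is arbitrary and \<open>R \<ge> 0\<close>, the conclusion yields points that are as large as desired.
\<close>
lemma heavy_tailed_hazard_sublinear:
  assumes X: "prob_space M" "X \<in> borel_measurable M" "ess_unbounded_above M X"
    and heavy: "heavy_tailed M X" and s: "0 < s"
  shows "\<exists>x\<ge>0. hazard M X x \<le> s * x - K"
proof (rule ccontr)
  assume "\<not> ?thesis"
  then have le: "s * x - K \<le> hazard M X x" if "0 \<le> x" for x
    using that by force
  have unbounded: "\<exists>x\<ge>0. t \<le> x" for t :: real by (intro exI[of _ "max 0 t"]) simp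
  have "expect_exp M (\<lambda>\<omega>. s / 2 * max 0 (X \<omega>)) < \<infinity>"
    by (rule expect_exp_finite[OF X, where h = "\<lambda>x. x" and c = s and K = K])
       (use s le unbounded in \<open>simp_all add: mono_on_def\<close>)
  moreover have "expect_exp M (\<lambda>\<omega>. s / 2 * X \<omega>) \<le> expect_exp M (\<lambda>\<omega>. s / 2 * max 0 (X \<omega>))"
    unfolding expect_exp_def using s by (intro nn_integral_mono) auto
  ultimately show False
    using heavy s by (auto simp: heavy_tailed_iff dest!: spec[of _ "s / 2"])
qed

section \<open>The limit inferior of the ratio and the two critical expectations\<close>

lemma Liminf_ratio_eq_1:
  fixes R h :: "real \<Rightarrow> real"
  assumes lim: "filterlim h at_top at_top"
    and le: "\<And>x. 0 \<le> x \<Longrightarrow> h x \<le> R x + K"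
    and touch: "\<And>N. \<exists>x\<ge>N. R x \<le> h x"
  shows "Liminf at_top (\<lambda>x. ereal (R x / h x)) = 1"
proof (rule antisym)
  have pos: "eventually (\<lambda>x. 0 < h x) at_top"
    using lim by (simp add: filterlim_at_top_dense)
  show "Liminf at_top (\<lambda>x. ereal (R x / h x)) \<le> 1"
  proof (rule ccontr)
    assume "\<not> ?thesis"
    then have "eventually (\<lambda>x. 1 < ereal (R x / h x)) at_top"
      by (intro less_LiminfD) (simp add: not_le)
    with pos have "eventually (\<lambda>x. h x < R x) at_top"
      by eventually_elim (simp add: one_ereal_def field_simps)
    then obtain N where "\<And>x. N \<le> x \<Longrightarrow> h x < R x"
      by (auto simp: eventually_at_top_linorder)
    then show False using touch[of N] by force
  qed
  have "((\<lambda>x. 1 - K / h x) \<longlongrightarrow> 1 - 0) at_top"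
    by (intro tendsto_diff tendsto_const real_tendsto_divide_at_top[OF tendsto_const] lim)
  then have "Liminf at_top (\<lambda>x. ereal (1 - K / h x)) = 1"
    by (intro lim_imp_Liminf) (simp_all add: one_ereal_def)
  moreover have "eventually (\<lambda>x. ereal (1 - K / h x) \<le> ereal (R x / h x)) at_top"
    using pos eventually_ge_at_top[of 0]
  proof eventually_elim
    case (elim x)
    then have "(h x - K) / h x \<le> R x / h x"
      using le[of x] by (intro divide_right_mono) auto
    then show ?case using elim by (simp add: diff_divide_distrib)
  qed
  ultimately show "1 \<le> Liminf at_top (\<lambda>x. ereal (R x / h x))"
    using Liminf_mono by metis
qed

theorem theorem3:
  fixes M :: "'a measure" and X :: "'a \<Rightarrow> real"
  assumes "prob_space M"
    and "X \<in> borel_measurable M"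
    and "ess_unbounded_above M X"
    and "heavy_tailed M X"
  shows "let
      A = (\<exists>h :: real \<Rightarrow> real. h \<in> {0..} \<rightarrow> {0..} \<and> concave_on {0..} h \<and> h 0 = 0 \<and>
             Liminf at_top (\<lambda>x. ereal (hazard M X x / h x)) = 1);
      B = (\<exists>(a::real) (b::real) (h :: real \<Rightarrow> real). 0 < a \<and> 0 < b \<and>
             h \<in> {0..} \<rightarrow> {0..} \<and> concave_on {0..} h \<and> h 0 = 0 \<and>
             expect_exp M (\<lambda>\<omega>. a * h (max 0 (X \<omega>))) < \<infinity> \<and>
             expect_exp M (\<lambda>\<omega>. b * h (max 0 (X \<omega>))) = \<infinity>)
    in (A \<longleftrightarrow> B) \<and> A \<and> B"
proof -
  note X = assms(1-3)
  let ?R = "hazard M X"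
  obtain h where h: "h \<in> {0..} \<rightarrow> {0..}" "concave_on {0..} h" "h 0 = 0"
    and mono: "mono_on {0..} h" and cont: "continuous_on {0..} h"
    and upper: "\<And>z. 0 \<le> z \<Longrightarrow> h z \<le> ?R z + 2"
    and touch: "\<And>N. \<exists>x\<ge>N. 0 \<le> x \<and> ?R x \<le> h x"
    using exists_concave_comparison[OF mono_hazard[OF X] hazard_nonneg[OF X]
        hazard_unbounded[OF X] heavy_tailed_hazard_sublinear[OF assms]] by metis
  \<comment> \<open>Since \<open>R\<close> is unbounded and monotone, \<open>h\<close> is large at the far vertices.\<close>
  have large: "\<exists>x\<ge>0. ?R x \<le> h x \<and> t \<le> h x" for t
  proof -
    obtain y where "t \<le> ?R y" using hazard_unbounded[OF X] by blast
    moreover obtain x where "y \<le> x" "0 \<le> x" "?R x \<le> h x" using touch by blast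
    ultimately show ?thesis using monoD[OF mono_hazard[OF X], of y x] by force
  qed
  have "filterlim h at_top at_top"
    unfolding filterlim_at_top eventually_at_top_linorder
  proof
    fix t
    obtain x where "0 \<le> x" "t \<le> h x" using large by blast
    then show "\<exists>N. \<forall>y\<ge>N. t \<le> h y"
      using mono_onD[OF mono, of x] by (intro exI[of _ x]) force
  qed
  then have "Liminf at_top (\<lambda>x. ereal (?R x / h x)) = 1"
  proof (rule Liminf_ratio_eq_1[where K = 2])
    show "\<exists>x\<ge>N. ?R x \<le> h x" for N
      using touch[of N] by blast
  qed (rule upper)
  moreover have "expect_exp M (\<lambda>\<omega>. 1 / 2 * h (max 0 (X \<omega>))) < \<infinity>"
    by (rule expect_exp_finite[OF X mono cont h(3), where c = 1 and K = 2])
       (use large upper in \<open>auto simp: algebra_simps\<close>)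
  moreover have "expect_exp M (\<lambda>\<omega>. 2 * h (max 0 (X \<omega>))) = \<infinity>"
  proof -
    have ge: "of_nat n \<le> expect_exp M (\<lambda>\<omega>. 2 * h (max 0 (X \<omega>)))" for n
    proof -
      obtain x where x: "0 \<le> x" "?R x \<le> h x" "real n \<le> h x" using large by blast
      have "real n \<le> 2 * h x - ?R x" using x by linarith
      also have "\<dots> \<le> exp (2 * h x - ?R x)"
        using exp_ge_add_one_self[of "2 * h x - ?R x"] by linarith
      finally have "real n \<le> exp (2 * h x - ?R x)" .
      from order_trans[OF ennreal_leI[OF this] expect_exp_ge[OF X mono x(1)]]
      show ?thesis by (simp add: ennreal_of_nat_eq_real_of_nat)
    qed
    show ?thesis
    proof (rule ccontr)
      assume "\<not> ?thesis"
      then have "expect_exp M (\<lambda>\<omega>. 2 * h (max 0 (X \<omega>))) < top"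
        unfolding infinity_ennreal_def less_top[symmetric] .
      then obtain n where "expect_exp M (\<lambda>\<omega>. 2 * h (max 0 (X \<omega>))) < of_nat n"
        using ennreal_Ex_less_of_nat by blast
      with ge[of n] show False by (simp add: leD)
    qed
  qed
  ultimately show ?thesis
    using h unfolding Let_def
    by (intro conjI iffI exI[of _ h] exI[of _ "1 / 2 :: real"] exI[of _ "2 :: real"]) auto
qed

end
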